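(* Let $k \geq 1$ be an integer and let $G$ be a graph without isolated vertices. Then $\gamma_{k}^t(G) \geq \mathrm{sub}_k^t(G)$.
   Context: All graphs are finite and simple; $d_G(u,v)$ is the length of a shortest $(u,v)$-path in $G$, and for $S \subseteq V(G)$, $d_G(v,S)=\min_{w\in S} d_G(v,w)$. For an integer $k\ge 1$ and a graph $G$ without isolated vertices, a set $S\subseteq V(G)$ is a total $k$-dominating set of $G$ if $d_G(v, S\setminus\{v\}) \le k$ for every $v \in V(G)$; the total $k$-domination number $\gamma_k^t(G)$ is the minimum cardinality of such a set. The $k$-neighborhood of $v$ is $N_{G,k}(v)=\{w : 1\le d_G(v,w)\le k\}$ and the $k$-degree of $v$ is $d_{G,k}(v)=|N_{G,k}(v)|$. If $G$ has order $n$, its $k$-degree sequence is the list $d_k^1 \ge d_k^2 \ge \dots \ge d_k^n$ of the $k$-degrees of all vertices in nonincreasing order. The sub-total $k$-domination number is $\mathrm{sub}_k^t(G)=\min\{ j : \sum_{i=1}^{j} d_k^i \ge n\}$. *)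

theory Defs
  imports "Graph_Theory.Graph_Theory"
begin

text \<open>A finite simple graph is a \<open>Graph_Theory\<close> \<open>graph\<close>: a finite, loop-free, symmetric digraph
  without parallel arcs, each undirected edge being a pair of opposite arcs.\<close>

definition isolated_vertex :: "('a, 'b) pre_digraph \<Rightarrow> 'a \<Rightarrow> bool" where
  "isolated_vertex G v \<longleftrightarrow> v \<in> verts G \<and> (\<forall>w. \<not> v \<rightarrow>\<^bsub>G\<^esub> w)"

text \<open>Distances are in \<open>enat\<close>, where an infimum over the empty set is \<open>\<infinity>\<close>: this is the distance
  between different components, and the distance from a vertex to the empty set.\<close>

definition graph_dist :: "('a, 'b) pre_digraph \<Rightarrow> 'a \<Rightarrow> 'a \<Rightarrow> enat" where
  "graph_dist G u v = (INF p \<in> {p. pre_digraph.apath G u p v}. enat (length p))"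

text \<open>This is the library's \<open>\<mu>\<close> for unit arc costs.\<close>

lemma ereal_of_graph_dist:
  assumes "graph G"
  shows "ereal_of_enat (graph_dist G u v) = wf_digraph.\<mu> G (\<lambda>_. 1) u v"
proof -
  interpret graph G by fact
  have cost: "awalk_cost (\<lambda>_. 1) p = real (length p)" for p
    by (simp add: awalk_cost_def sum_list_triv)
  show ?thesis
  proof (cases "u \<rightarrow>\<^sup>*\<^bsub>G\<^esub> v")
    case True
    then obtain p where p: "apath u p v" "\<mu> (\<lambda>_. 1) u v = ereal (length p)"
      using min_cost_awalk[of u v "\<lambda>_. 1"] cost by auto
    have "length p \<le> length q" if "apath u q v" for q
      using min_cost_le_walk_cost[OF awalkI_apath[OF that], of "\<lambda>_. 1"] p(2) cost by simp
    then have "graph_dist G u v = enat (length p)"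
      unfolding graph_dist_def using p(1) by (intro antisym INF_lower INF_greatest) auto
    then show ?thesis using p(2) by simp
  next
    case False
    then have "{p. apath u p v} = {}" by (auto simp: reachable_apath)
    then have "graph_dist G u v = \<infinity>" by (simp add: graph_dist_def top_enat_def)
    then show ?thesis using shortest_path_inf[OF False] by simp
  qed
qed

definition graph_set_dist :: "('a, 'b) pre_digraph \<Rightarrow> 'a \<Rightarrow> 'a set \<Rightarrow> enat" where
  "graph_set_dist G v S = (INF w \<in> S. graph_dist G v w)"

definition total_dominating :: "('a, 'b) pre_digraph \<Rightarrow> nat \<Rightarrow> 'a set \<Rightarrow> bool" where
  "total_dominating G k S \<longleftrightarrow>
     S \<subseteq> verts G \<and> (\<forall>v \<in> verts G. graph_set_dist G v (S - {v}) \<le> enat k)"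

definition total_domination_number :: "('a, 'b) pre_digraph \<Rightarrow> nat \<Rightarrow> nat" where
  "total_domination_number G k = (LEAST c. \<exists>S. total_dominating G k S \<and> card S = c)"

definition k_neighborhood :: "('a, 'b) pre_digraph \<Rightarrow> nat \<Rightarrow> 'a \<Rightarrow> 'a set" where
  "k_neighborhood G k v = {w \<in> verts G. 1 \<le> graph_dist G v w \<and> graph_dist G v w \<le> enat k}"

definition k_degree :: "('a, 'b) pre_digraph \<Rightarrow> nat \<Rightarrow> 'a \<Rightarrow> nat" where
  "k_degree G k v = card (k_neighborhood G k v)"

definition k_degree_sequence :: "('a, 'b) pre_digraph \<Rightarrow> nat \<Rightarrow> nat list" where
  "k_degree_sequence G k =
     rev (sorted_list_of_multiset (image_mset (k_degree G k) (mset_set (verts G))))"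

text \<open>The sequence has length \<open>card (verts G)\<close>, so \<open>take j\<close> is the whole sequence for larger \<open>j\<close>.\<close>

definition sub_total_domination_number :: "('a, 'b) pre_digraph \<Rightarrow> nat \<Rightarrow> nat" where
  "sub_total_domination_number G k =
     (LEAST j. sum_list (take j (k_degree_sequence G k)) \<ge> card (verts G))"

text \<open>Both minima range over nonempty sets when \<open>k \<ge> 1\<close> and no vertex is isolated.\<close>

lemma graph_dist_neighbor:
  assumes "graph G" "v \<rightarrow>\<^bsub>G\<^esub> w"
  shows "w \<in> verts G" "w \<noteq> v" "graph_dist G v w = 1"
proof -
  interpret graph G by fact
  obtain e where e: "e \<in> arcs G" "tail G e = v" "head G e = w"
    using assms(2) by (auto simp: arcs_ends_conv)
  show "w \<in> verts G" using e by auto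
  show ne: "w \<noteq> v" using no_loops[OF e(1)] e by simp
  have "apath v [e] w"
    using e ne by (auto simp: apath_def awalk_def)
  then have "graph_dist G v w \<le> enat (length [e])"
    unfolding graph_dist_def by (intro INF_lower) simp
  moreover have "1 \<le> graph_dist G v w"
    unfolding graph_dist_def
  proof (rule INF_greatest)
    fix p assume "p \<in> {p. apath v p w}"
    then have "p \<noteq> []" using ne by (auto simp: apath_def awalk_def)
    then show "1 \<le> enat (length p)"
      by (cases p) (auto simp: one_enat_def)
  qed
  ultimately show "graph_dist G v w = 1"
    by (simp add: one_enat_def order_antisym)
qed

lemma total_dominating_verts:
  assumes "graph G" "k \<ge> 1" "\<And>v. \<not> isolated_vertex G v"
  shows "total_dominating G k (verts G)"
  unfolding total_dominating_def
proof (intro conjI ballI)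
  fix v assume "v \<in> verts G"
  then obtain w where w: "v \<rightarrow>\<^bsub>G\<^esub> w"
    using assms(3) unfolding isolated_vertex_def by blast
  note n = graph_dist_neighbor[OF assms(1) w]
  have "graph_set_dist G v (verts G - {v}) \<le> graph_dist G v w"
    unfolding graph_set_dist_def using n(1,2) by (intro INF_lower) auto
  then show "graph_set_dist G v (verts G - {v}) \<le> enat k"
    using n(3) assms(2) by (simp add: one_enat_def order_trans)
qed simp

lemma sum_k_degree_sequence_ge:
  assumes "graph G" "k \<ge> 1" "\<And>v. \<not> isolated_vertex G v"
  shows "sum_list (take (card (verts G)) (k_degree_sequence G k)) \<ge> card (verts G)"
proof -
  interpret graph G by fact
  have mset: "mset (k_degree_sequence G k) = image_mset (k_degree G k) (mset_set (verts G))"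
    by (simp add: k_degree_sequence_def)
  have "length (k_degree_sequence G k) = card (verts G)"
    using arg_cong[OF mset, of size] by simp
  moreover have "sum_list (k_degree_sequence G k) = (\<Sum>v \<in> verts G. k_degree G k v)"
    using arg_cong[OF mset, of sum_mset] by (simp add: sum_mset_sum_list sum_unfold_sum_mset)
  moreover have "k_degree G k v \<ge> 1" if "v \<in> verts G" for v
  proof -
    obtain w where w: "v \<rightarrow>\<^bsub>G\<^esub> w"
      using assms(3) \<open>v \<in> verts G\<close> unfolding isolated_vertex_def by blast
    have "w \<in> k_neighborhood G k v"
      using graph_dist_neighbor[OF assms(1) w] assms(2)
      by (simp add: k_neighborhood_def one_enat_def)
    moreover have "finite (k_neighborhood G k v)"
      by (simp add: k_neighborhood_def)
    ultimately show ?thesis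
      unfolding k_degree_def by (metis One_nat_def Suc_leI card_gt_0_iff empty_iff)
  qed
  then have "card (verts G) \<le> (\<Sum>v \<in> verts G. k_degree G k v)"
    using sum_mono[of "verts G" "\<lambda>_. 1" "k_degree G k"] by simp
  ultimately show ?thesis by simp
qed

end

theory Submission
  imports Defs
begin

text \<open>Distance is symmetric, so the vertices \<open>k\<close>-dominated by \<open>w \<in> S\<close> are exactly its
  \<open>k\<close>-neighborhood. A total \<open>k\<close>-dominating set \<open>S\<close> thus covers the vertex set by the
  \<open>k\<close>-neighborhoods of its members, whose sizes add up to at most the sum of the \<open>card S\<close> largest
  \<open>k\<close>-degrees.\<close>

text \<open>Greedy exchange along \<open>xs\<close>: drop the head \<open>x\<close> from
  \<open>A\<close> if it occurs there, otherwise drop any element. The dropped element is at most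
  \<open>x\<close>, and the remainder still embeds in the tail.\<close>

lemma sum_mset_le_sum_list_take:
  fixes xs :: "'a::ordered_comm_monoid_add list"
  assumes "sorted_wrt (\<ge>) xs" "A \<subseteq># mset xs"
  shows "\<Sum>\<^sub># A \<le> sum_list (take (size A) xs)"
  using assms
proof (induction xs arbitrary: A)
  case Nil
  then show ?case by simp
next
  case (Cons x xs)
  show ?case
  proof (cases "A = {#}")
    case False
    obtain a B where A: "A = add_mset a B" and B: "B \<subseteq># mset xs"
    proof (cases "x \<in># A")
      case True
      then obtain B where "A = add_mset x B" by (blast dest: multi_member_split)
      then show thesis using that Cons.prems(2) by auto
    next
      case x: False
      obtain a B where A: "A = add_mset a B" using False by (auto dest: multi_nonempty_split)
      \<comment> \<open>Inclusion is read as \<open>A\<close> being its own intersection with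
        \<open>mset (x # xs)\<close>; since \<open>x\<close> is not in \<open>A\<close>, it
        contributes nothing there.\<close>
      have "A \<subseteq># mset xs"
        using Cons.prems(2) x by (simp add: inter_add_right1 subset_mset.inf.order_iff)
      then have "B \<subseteq># mset xs" using A by (auto dest: mset_subset_eq_insertD subset_mset.less_imp_le)
      then show thesis using that A by blast
    qed
    have "a \<in> set (x # xs)" using Cons.prems(2) A by (auto dest: mset_subset_eqD)
    then have "a \<le> x" using Cons.prems(1) by auto
    moreover have "\<Sum>\<^sub># B \<le> sum_list (take (size B) xs)"
      using Cons.IH[OF _ B] Cons.prems(1) by simp
    ultimately show ?thesis using A by (simp add: add_mono)
  qed simp
qed

context graph
begin

text \<open>An undirected edge is a pair of opposite arcs, so the reversed walk uses other arcs than
  \<open>p\<close>; symmetry supplies the opposite of each.\<close>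

lemma awalk_reverse:
  assumes "awalk u p v"
  obtains q where "awalk v q u" "length q = length p"
  using assms
proof (induction p arbitrary: u thesis)
  case Nil
  then show ?case by (auto simp: awalk_Nil_iff)
next
  case (Cons e p)
  from Cons.prems(2) have e: "e \<in> arcs G" "tail G e = u" and p: "awalk (head G e) p v"
    by (auto simp: awalk_Cons_iff)
  obtain q where q: "awalk v q (head G e)" "length q = length p" using Cons.IH p by blast
  have "u \<rightarrow>\<^bsub>G\<^esub> head G e" using e by (auto intro: in_arcs_imp_in_arcs_ends)
  then have "head G e \<rightarrow>\<^bsub>G\<^esub> u" by (rule graph_symmetric)
  then obtain f where f: "f \<in> arcs G" "tail G f = head G e" "head G f = u" by auto
  then have "awalk (head G e) [f] u" by (auto simp: awalk_Cons_iff awalk_Nil_iff)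
  then have "awalk v (q @ [f]) u" using q(1) by (blast intro: awalk_appendI)
  then show ?case by (rule Cons.prems(1)) (simp add: q(2))
qed

text \<open>\<open>graph_dist\<close> minimises over paths only, while reversal is only known to
  yield walks. The bound for walks comes from the identification with \<open>\<mu>\<close> for unit
  costs.\<close>

lemma graph_dist_le_awalk:
  assumes "awalk u p v"
  shows "graph_dist G u v \<le> enat (length p)"
proof -
  have "ereal_of_enat (graph_dist G u v) \<le> awalk_cost (\<lambda>_. 1) p"
    using ereal_of_graph_dist[OF graph_axioms] min_cost_le_walk_cost[OF assms] by simp
  also have "awalk_cost (\<lambda>_. 1) p = ereal_of_enat (enat (length p))"
    by (simp add: awalk_cost_def sum_list_triv)
  finally show ?thesis by (simp only: ereal_of_enat_le_iff)
qed

lemma graph_dist_commute: "graph_dist G u v = graph_dist G v u"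
proof -
  have "graph_dist G u v \<le> graph_dist G v u" for u v
    unfolding graph_dist_def[of G v u]
  proof (rule INF_greatest)
    fix p assume "p \<in> {p. apath v p u}"
    then obtain q where "awalk u q v" "length q = length p"
      using awalk_reverse[of v p u] awalkI_apath by blast
    then show "graph_dist G u v \<le> enat (length p)" using graph_dist_le_awalk by metis
  qed
  then show ?thesis by (simp add: antisym)
qed

lemma one_le_graph_dist:
  assumes "u \<noteq> v"
  shows "1 \<le> graph_dist G u v"
  unfolding graph_dist_def
proof (rule INF_greatest)
  fix p assume "p \<in> {p. apath u p v}"
  then have "p \<noteq> []" using assms by (auto simp: apath_Nil_iff)
  then show "1 \<le> enat (length p)" by (cases p) (auto simp: one_enat_def)
qed

lemma total_dominating_card_le:
  assumes "total_dominating G k S"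
  shows "card (verts G) \<le> (\<Sum>w \<in> S. k_degree G k w)"
proof -
  have S: "S \<subseteq> verts G" using assms by (simp add: total_dominating_def)
  then have fin: "finite S" by (rule finite_subset) simp
  have "verts G \<subseteq> (\<Union>w \<in> S. k_neighborhood G k w)"
  proof
    fix v assume v: "v \<in> verts G"
    then have "graph_set_dist G v (S - {v}) \<le> enat k"
      using assms by (simp add: total_dominating_def)
    \<comment> \<open>A strict bound on an infimum yields a member below it. This also excludes an
      empty \<open>S - {v}\<close>, where the infimum is \<infinity>.\<close>
    then have "graph_set_dist G v (S - {v}) < enat (Suc k)"
      by (rule order.strict_trans1) simp
    then obtain w where w: "w \<in> S" "w \<noteq> v" "graph_dist G v w < enat (Suc k)"
      by (auto simp: graph_set_dist_def INF_less_iff)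
    then have "graph_dist G v w \<le> enat k" by (cases "graph_dist G v w") auto
    \<comment> \<open>A \<open>k_neighborhood\<close> omits its centre; the lower bound 1 on the
      distance comes from choosing \<open>w\<close> in \<open>S - {v}\<close>.\<close>
    then have "v \<in> k_neighborhood G k w"
      using v w(2) one_le_graph_dist graph_dist_commute[of v w] by (simp add: k_neighborhood_def)
    then show "v \<in> (\<Union>w \<in> S. k_neighborhood G k w)" using w(1) by blast
  qed
  moreover have "finite (\<Union>w \<in> S. k_neighborhood G k w)"
    using fin by (simp add: k_neighborhood_def)
  ultimately have "card (verts G) \<le> card (\<Union>w \<in> S. k_neighborhood G k w)"
    by (simp add: card_mono)
  also have "\<dots> \<le> (\<Sum>w \<in> S. k_degree G k w)"
    unfolding k_degree_def by (rule card_UN_le[OF fin])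
  finally show ?thesis .
qed

text \<open>The degrees over \<open>S\<close>, counted with multiplicity, form a submultiset of the
  nonincreasing degree sequence.\<close>

lemma sum_k_degree_le_take:
  assumes "S \<subseteq> verts G"
  shows "(\<Sum>w \<in> S. k_degree G k w) \<le> sum_list (take (card S) (k_degree_sequence G k))"
proof -
  let ?A = "image_mset (k_degree G k) (mset_set S)"
  have "?A \<subseteq># mset (k_degree_sequence G k)"
    using assms by (simp add: k_degree_sequence_def image_mset_subseteq_mono subset_imp_msubset_mset_set)
  moreover have "sorted_wrt (\<ge>) (k_degree_sequence G k)"
    by (simp add: k_degree_sequence_def sorted_wrt_rev)
  ultimately have "\<Sum>\<^sub># ?A \<le> sum_list (take (size ?A) (k_degree_sequence G k))"
    by (intro sum_mset_le_sum_list_take)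
  then show ?thesis by (simp add: sum_unfold_sum_mset)
qed

end

theorem theorem3p1:
  fixes G :: "('a, 'b) pre_digraph" and k :: nat
  assumes "k \<ge> 1" and "graph G" and "\<forall>v \<in> verts G. \<not> isolated_vertex G v"
  shows "total_domination_number G k \<ge> sub_total_domination_number G k"
proof -
  interpret graph G by fact
  have "total_dominating G k (verts G)"
    using assms by (intro total_dominating_verts) (auto simp: isolated_vertex_def)
  \<comment> \<open>This witness ensures that the \<open>LEAST\<close> in
    \<open>total_domination_number\<close> is attained by an actual set.\<close>
  then have "\<exists>S. total_dominating G k S \<and> card S = card (verts G)" by blast
  then have "\<exists>S. total_dominating G k S \<and> card S = total_domination_number G k"
    unfolding total_domination_number_def by (rule LeastI)
  then obtain S where S: "total_dominating G k S" "card S = total_domination_number G k"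
    by blast
  then have "S \<subseteq> verts G" by (simp add: total_dominating_def)
  then have "card (verts G) \<le> sum_list (take (card S) (k_degree_sequence G k))"
    using total_dominating_card_le[OF S(1)] sum_k_degree_le_take by (blast intro: order_trans)
  \<comment> \<open>The index \<open>j = card S\<close> is admissible in the minimum that defines
    \<open>sub_total_domination_number\<close>.\<close>
  then show ?thesis
    unfolding sub_total_domination_number_def S(2) by (rule Least_le)
qed

end
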